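(* Fix $v\in\mathbb R^m$ with $v\neq 0$ and suppose $\Sigma=\mathbb E[xx^\top]\succ 0$. Let $L(W,0)=\tfrac12\mathbb E[(v^\top Wx-y)^2]$ for $W\in\mathbb R^{m\times d}$. Then the Hessian of $L(\cdot,0)$ with respect to $\operatorname{vec}(W)$ is $$H_0=(vv^\top)\otimes\Sigma .$$ This matrix has rank $d$ and kernel of dimension $(m-1)d$, regardless of whether the entries of $v$ are distinct. Its nonzero eigenvalues are $\|v\|^2\lambda_k(\Sigma)$, $k=1,\dots,d$.
   Context: $(x,y)\sim\mathcal D$ is a data distribution on $\mathbb R^d\times\mathbb R$ (with finite second moments), $\Sigma:=\mathbb E[xx^\top]\in\mathbb R^{d\times d}$, and $\lambda_1(\Sigma),\dots,\lambda_d(\Sigma)$ are the eigenvalues of $\Sigma$ counted with multiplicity. $L(W,0)$ is the mean-squared error loss of the linear two-layer network $x\mapsto v^\top Wx$ with $v$ fixed. $W$ has rows $w_1^\top,\dots,w_m^\top$, and $\operatorname{vec}(W)\in\mathbb R^{md}$ stacks the rows $w_1,\dots,w_m$, so that $\otimes$ is the Kronecker product with $(j,k)$ block $v_jv_k\Sigma$. *)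

theory Defs
  imports "HOL-Analysis.Analysis" "HOL-Probability.Probability"
    "HOL-Computational_Algebra.Computational_Algebra"
begin

definition data_distribution :: "((real^'d) \<times> real) measure \<Rightarrow> bool" where
  "data_distribution D \<longleftrightarrow>
     prob_space D \<and> sets D = sets borel \<and>
     integrable D (\<lambda>(x, y). (norm x)\<^sup>2) \<and> integrable D (\<lambda>(x, y). y\<^sup>2)"

definition second_moment :: "((real^'d) \<times> real) measure \<Rightarrow> real^'d^'d" where
  "second_moment D = (\<chi> i k. \<integral>(x, y). x $ i * x $ k \<partial>D)"

definition positive_definite :: "real^'n^'n \<Rightarrow> bool" where
  "positive_definite A \<longleftrightarrow>
     transpose A = A \<and> (\<forall>u. u \<noteq> 0 \<longrightarrow> 0 < u \<bullet> (A *v u))"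

definition loss :: "((real^'d) \<times> real) measure \<Rightarrow> real^'m \<Rightarrow> real^'d^'m \<Rightarrow> real" where
  "loss D v W = 1 / 2 * (\<integral>(x, y). (v \<bullet> (W *v x) - y)\<^sup>2 \<partial>D)"

text \<open>
  Vectors in \<open>\<real>\<^sup>m\<^sup>d\<close> are indexed by pairs: the first component of an index selects the
  block (the row of \<open>W\<close>), the second one the position inside the block.
\<close>

definition vec_of_matrix :: "real^'d^'m \<Rightarrow> real^('m \<times> 'd)" where
  "vec_of_matrix W = (\<chi> p. W $ fst p $ snd p)"

definition matrix_of_vec :: "real^('m \<times> 'd) \<Rightarrow> real^'d^'m" where
  "matrix_of_vec w = (\<chi> j i. w $ (j, i))"

lemma matrix_of_vec_of_matrix [simp]: "matrix_of_vec (vec_of_matrix W) = W"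
  by (simp add: matrix_of_vec_def vec_of_matrix_def vec_eq_iff)

lemma vec_of_matrix_of_vec [simp]: "vec_of_matrix (matrix_of_vec w) = w"
  by (simp add: matrix_of_vec_def vec_of_matrix_def vec_eq_iff)

definition kronecker :: "real^'m^'m \<Rightarrow> real^'d^'d \<Rightarrow> real^('m \<times> 'd)^('m \<times> 'd)" where
  "kronecker A B = (\<chi> p q. A $ fst p $ fst q * B $ snd p $ snd q)"

definition outer_product :: "real^'m \<Rightarrow> real^'n \<Rightarrow> real^'n^'m" where
  "outer_product u v = (\<chi> j k. u $ j * v $ k)"

text \<open>
  \<open>H\<close> is the Hessian of \<open>f\<close> at \<open>a\<close>: \<open>f\<close> has a gradient near \<open>a\<close>, and \<open>H\<close> is the
  Jacobian matrix at \<open>a\<close> of the gradient. Such an \<open>H\<close> is unique.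
\<close>

definition has_hessian :: "(real^'n \<Rightarrow> real) \<Rightarrow> real^'n^'n \<Rightarrow> real^'n \<Rightarrow> bool" where
  "has_hessian f H a \<longleftrightarrow>
     (\<exists>g. (\<forall>\<^sub>F x in nhds a. GDERIV f x :> g x) \<and> (g has_derivative (\<lambda>h. H *v h)) (at a))"

lemma has_hessian_unique:
  assumes "has_hessian f H a" "has_hessian f H' a"
  shows "H = H'"
proof -
  obtain g where g: "\<forall>\<^sub>F x in nhds a. GDERIV f x :> g x"
      "(g has_derivative (\<lambda>h. H *v h)) (at a)"
    using assms(1) by (auto simp: has_hessian_def)
  obtain g' where g': "\<forall>\<^sub>F x in nhds a. GDERIV f x :> g' x"
      "(g' has_derivative (\<lambda>h. H' *v h)) (at a)"
    using assms(2) by (auto simp: has_hessian_def)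
  have uniq: "u = u'" if "GDERIV f x :> u" "GDERIV f x :> u'" for x u u'
  proof -
    have "(\<lambda>h. h \<bullet> u) = (\<lambda>h. h \<bullet> u')"
      using that has_derivative_unique unfolding gderiv_def by blast
    then show ?thesis
      by (metis vector_eq_ldot)
  qed
  have ev: "\<forall>\<^sub>F x in nhds a. g' x = g x"
    using g(1) g'(1) by eventually_elim (rule uniq)
  then have "g' a = g a"
    by (rule eventually_nhds_x_imp_x)
  moreover have "\<forall>\<^sub>F x in at a. g' x = g x"
    using ev by (auto simp: eventually_at_filter elim: eventually_mono)
  ultimately have "(g has_derivative (\<lambda>h. H' *v h)) (at a)"
    using has_derivative_transform_eventually[OF g'(2)] by auto
  then have "(\<lambda>h. H *v h) = (\<lambda>h. H' *v h)"
    using g(2) has_derivative_unique by blast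
  then show ?thesis
    by (metis matrix_eq)
qed

definition charpoly :: "real^'n^'n \<Rightarrow> real poly" where
  "charpoly A = det (mat [:0, 1:] - (\<chi> i j. [:A $ i $ j:]))"

text \<open>The real eigenvalues, each repeated according to its algebraic multiplicity.\<close>

definition eigenvalues :: "real^'n^'n \<Rightarrow> real multiset" where
  "eigenvalues A = proots (charpoly A)"

end

theory Submission
  imports Defs
begin

text \<open>
  Since \<open>v \<bullet> (W x) = (\<Sum>\<^sub>j v\<^sub>j w\<^sub>j) \<bullet> x\<close>, the loss is a quadratic polynomial in \<open>vec W\<close>
  with quadratic part \<open>w \<bullet> (H\<^sub>0 w) / 2\<close>.
  The matrix \<open>H\<^sub>0\<close> maps \<open>z\<close> to \<open>v \<otimes> \<Sigma> (\<Sum>\<^sub>j v\<^sub>j z\<^sub>j)\<close>, so its range is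
  \<open>v \<otimes> \<real>\<^sup>d\<close>. For the spectrum with multiplicities, take an orthonormal eigenbasis of
  \<open>\<Sigma>\<close> and an orthonormal basis of \<open>\<real>\<^sup>m\<close> containing \<open>v / \<parallel>v\<parallel>\<close>: the products
  \<open>a\<^sub>j \<otimes> b\<^sub>i\<close> diagonalise \<open>H\<^sub>0\<close>, and only those with \<open>a\<^sub>j = v / \<parallel>v\<parallel>\<close>
  have a nonzero eigenvalue.
\<close>

section \<open>Spectral theorem for self-adjoint maps\<close>

text \<open>A maximiser \<open>x\<close> of the Rayleigh quotient over the compact unit sphere of
  \<open>S\<close> is an eigenvector: by invariance its residual \<open>c x - f x\<close> lies in
  \<open>S\<close>, so \<open>x\<close> may be varied in that direction, and maximality forces the
  residual to vanish.\<close>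

lemma selfadjoint_eigenvector_exists:
  fixes f :: "'a::euclidean_space \<Rightarrow> 'a"
  assumes lin: "linear f" and sym: "\<And>x y. f x \<bullet> y = x \<bullet> f y"
    and S: "subspace S" "f ` S \<subseteq> S" "S \<noteq> {0}"
  obtains x c where "x \<in> S" "norm x = 1" "f x = c *\<^sub>R x"
proof -
  let ?K = "S \<inter> sphere 0 1"
  have "compact ?K"
    using S(1) by (simp add: closed_Int_compact closed_subspace)
  moreover have "?K \<noteq> {}"
  proof -
    obtain u where u: "u \<in> S" "u \<noteq> 0"
      using S(1,3) subspace_0 by blast
    then have "u /\<^sub>R norm u \<in> ?K"
      using S(1) by (simp add: subspace_scale)
    then show ?thesis by blast
  qed
  moreover have "continuous_on ?K (\<lambda>x. x \<bullet> f x)"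
    using lin by (intro continuous_intros linear_continuous_on) (simp add: linear_conv_bounded_linear)
  ultimately obtain x where x: "x \<in> ?K" and max: "\<And>y. y \<in> ?K \<Longrightarrow> y \<bullet> f y \<le> x \<bullet> f x"
    using continuous_attains_sup by metis
  define c where "c = x \<bullet> f x"
  have xS: "x \<in> S" and nx: "norm x = 1" and xx: "x \<bullet> x = 1"
    using x by (auto simp: norm_eq_1)
  have bound: "y \<bullet> f y \<le> c * (y \<bullet> y)" if "y \<in> S" for y
  proof (cases "y = 0")
    case False
    have "y /\<^sub>R norm y \<in> ?K"
      using that False S(1) by (simp add: subspace_scale)
    from max[OF this] have "(y \<bullet> f y) / (norm y)\<^sup>2 \<le> c"
      using lin by (simp add: c_def linear_scale power2_eq_square divide_inverse mult.commute
          mult.left_commute)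
    with False show ?thesis
      by (simp add: divide_simps power2_norm_eq_inner)
  qed (simp add: linear_0[OF lin])
  define z where "z = c *\<^sub>R x - f x"
  have zS: "z \<in> S"
    using xS S by (auto simp: z_def intro!: subspace_diff subspace_scale)
  \<comment> \<open>The form \<open>y \<mapsto> c (y \<bullet> y) - y \<bullet> f y\<close> is nonnegative on \<open>S\<close> and vanishes at \<open>x\<close>;
    on the line \<open>x + t z\<close> its linear coefficient \<open>2 (z \<bullet> z)\<close> must therefore vanish.\<close>
  define q where "q = c * (z \<bullet> z) - z \<bullet> f z"
  have nonneg: "0 \<le> 2 * t * (z \<bullet> z) + t\<^sup>2 * q" for t
  proof -
    have "x + t *\<^sub>R z \<in> S"
      using xS zS S(1) by (simp add: subspace_add subspace_scale)
    from bound[OF this]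
    have "0 \<le> c * ((x + t *\<^sub>R z) \<bullet> (x + t *\<^sub>R z)) - (x + t *\<^sub>R z) \<bullet> f (x + t *\<^sub>R z)"
      by simp
    also have "\<dots> = c * (x \<bullet> x) - x \<bullet> f x + 2 * t * (c * (x \<bullet> z) - f x \<bullet> z)
        + t\<^sup>2 * (c * (z \<bullet> z) - z \<bullet> f z)"
      using lin sym[of x z] by (simp add: linear_add linear_scale inner_add_left inner_add_right
          power2_eq_square algebra_simps inner_commute)
    \<comment> \<open>Only the left factor of \<open>z \<bullet> z\<close> is unfolded; linearity in
      that factor gives the other side.\<close>
    also have "c * (x \<bullet> z) - f x \<bullet> z = z \<bullet> z"
      by (subst (3) z_def) (simp add: inner_diff_left)
    finally show ?thesis
      by (simp add: xx c_def q_def)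
  qed
  have "z \<bullet> z = 0"
  proof (rule ccontr)
    assume "z \<bullet> z \<noteq> 0"
    then have pos: "z \<bullet> z > 0"
      by (simp add: order_less_le)
    \<comment> \<open>Negative and so small that \<open>t * q \<ge> - (z \<bullet> z)\<close>, which
      leaves \<open>2 * (z \<bullet> z) + t * q\<close> positive; the summand 1 keeps the
      denominator nonzero when \<open>q = 0\<close>.\<close>
    define t where "t = - (z \<bullet> z) / (\<bar>q\<bar> + 1)"
    have t: "t < 0" "t * (\<bar>q\<bar> + 1) = - (z \<bullet> z)"
      using pos by (simp_all add: t_def field_simps)
    have "t * (2 * (z \<bullet> z) + t * q) \<ge> 0"
      using nonneg[of t] by (simp add: power2_eq_square algebra_simps)
    then have "2 * (z \<bullet> z) + t * q \<le> 0"
      using t(1) by (simp add: zero_le_mult_iff)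
    moreover have "t * q \<ge> t * (\<bar>q\<bar> + 1)"
      using t(1) by (intro mult_left_mono_neg) auto
    ultimately show False
      using t(2) pos by linarith
  qed
  then have "f x = c *\<^sub>R x"
    by (simp add: z_def)
  with xS nx that show ?thesis by blast
qed

text \<open>An orthonormal set of eigenvectors is independent, so one of greatest cardinality
  exists. Self-adjointness makes its orthogonal complement invariant; a nonzero complement would
  contain one more unit eigenvector.\<close>

theorem selfadjoint_orthonormal_eigenbasis:
  fixes f :: "'a::euclidean_space \<Rightarrow> 'a"
  assumes lin: "linear f" and sym: "\<And>x y. f x \<bullet> y = x \<bullet> f y"
  obtains B where "pairwise orthogonal B" "\<And>x. x \<in> B \<Longrightarrow> norm x = 1"
    "card B = DIM('a)" "\<And>x. x \<in> B \<Longrightarrow> \<exists>c. f x = c *\<^sub>R x"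
proof -
  define good where "good B \<longleftrightarrow> pairwise orthogonal B \<and>
      (\<forall>x\<in>B. norm x = 1 \<and> (\<exists>c. f x = c *\<^sub>R x))" for B :: "'a set"
  have indep: "independent B" if "good B" for B
    using that by (intro pairwise_orthogonal_independent) (auto simp: good_def)
  have "good {}"
    by (simp add: good_def)
  moreover have "\<forall>B. good B \<longrightarrow> card B < Suc (DIM('a))"
    using indep independent_bound by (auto simp: less_Suc_eq_le)
  ultimately obtain B where B: "good B" and max: "\<And>C. good C \<Longrightarrow> card C \<le> card B"
    using ex_has_greatest_nat[of good "{}" card "Suc (DIM('a))"] by (metis less_imp_le)
  have fin: "finite B"
    using indep[OF B] independent_bound by blast
  have "span B = UNIV"
  proof (rule ccontr)
    assume "span B \<noteq> UNIV"
    then obtain a where a: "a \<noteq> 0" "\<And>x. x \<in> span B \<Longrightarrow> orthogonal a x"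
      using orthogonal_to_subspace_exists_gen[of B UNIV] by (metis psubsetI span_UNIV subset_UNIV)
    define S where "S = {y. \<forall>x\<in>B. x \<bullet> y = 0}"
    have "subspace S"
      by (auto simp: S_def subspace_def inner_add_right)
    moreover have "f ` S \<subseteq> S"
    proof -
      have "x \<bullet> f y = 0" if "y \<in> S" "x \<in> B" for x y
      proof -
        obtain c where "f x = c *\<^sub>R x"
          using \<open>x \<in> B\<close> B by (auto simp: good_def)
        then show ?thesis
          using that sym[of x y] by (simp add: S_def)
      qed
      then show ?thesis by (auto simp: S_def)
    qed
    moreover have "a \<in> S"
      using a(2) by (auto simp: S_def orthogonal_def span_base inner_commute)
    then have "S \<noteq> {0}"
      using a(1) by blast
    ultimately obtain x c where x: "x \<in> S" "norm x = 1" "f x = c *\<^sub>R x"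
      using selfadjoint_eigenvector_exists[OF lin sym] by metis
    have "good (insert x B)"
      using B x by (auto simp: good_def S_def orthogonal_def pairwise_insert inner_commute)
    moreover have "x \<notin> B"
      using x(1,2) by (auto simp: S_def norm_eq_1)
    ultimately show False
      using max[of "insert x B"] fin by simp
  qed
  then have "card B = DIM('a)"
    by (metis B indep dim_UNIV dim_eq_card span_UNIV)
  then show ?thesis
    using B that[of B] by (auto simp: good_def)
qed

section \<open>Eigenbases, characteristic polynomials, rank and nullity\<close>

text \<open>Indexing by \<open>'n\<close> itself lets \<open>d\<close> repeat eigenvalues, makes the
  vectors \<open>b i\<close> the columns of an orthogonal matrix, and makes a product of two bases
  indexed by pairs, as in \<open>kronecker\<close>.\<close>

definition orthonormal_eigenbasis :: "real^'n^'n \<Rightarrow> ('n \<Rightarrow> real) \<Rightarrow> ('n \<Rightarrow> real^'n) \<Rightarrow> bool" where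
  "orthonormal_eigenbasis A d b \<longleftrightarrow>
     (\<forall>i j. b i \<bullet> b j = (if i = j then 1 else 0)) \<and> (\<forall>i. A *v b i = d i *\<^sub>R b i)"

text \<open>The bijection is part of the result because a prescribed member of \<open>B\<close> must
  later be located at some index.\<close>

lemma orthonormal_set_enumeration:
  fixes B :: "(real^'n) set"
  assumes "pairwise orthogonal B" "\<And>x. x \<in> B \<Longrightarrow> norm x = 1" "card B = CARD('n)"
  obtains b :: "'n \<Rightarrow> real^'n"
  where "bij_betw b UNIV B" "\<And>i j. b i \<bullet> b j = (if i = j then 1 else 0)"
proof -
  \<comment> \<open>An infinite set has \<open>card\<close> equal to 0, so a positive cardinality
    implies finiteness.\<close>
  have "finite B"
    using assms(3) by (metis card_gt_0_iff zero_less_card_finite)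
  then obtain b :: "'n \<Rightarrow> real^'n" where b: "bij_betw b UNIV B"
    using assms(3) by (metis finite_same_card_bij finite)
  have "b i \<bullet> b j = (if i = j then 1 else 0)" for i j
  proof (cases "i = j")
    case True
    then show ?thesis
      using assms(2) b by (auto simp: bij_betw_def norm_eq_1[symmetric])
  next
    case False
    then have "b i \<noteq> b j"
      using b by (auto simp: bij_betw_def inj_on_def)
    then show ?thesis
      using assms(1) b False by (auto simp: bij_betw_def pairwise_def orthogonal_def)
  qed
  with b that show ?thesis by blast
qed

lemma symmetric_matrix_eigenbasis:
  fixes A :: "real^'n^'n"
  assumes "transpose A = A"
  obtains d b where "orthonormal_eigenbasis A d b"
proof -
  have "(A *v x) \<bullet> y = x \<bullet> (A *v y)" for x y
    by (metis assms dot_lmul_matrix inner_commute transpose_matrix_vector)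
  then obtain B where B: "pairwise orthogonal B" "\<And>x. x \<in> B \<Longrightarrow> norm x = 1"
      "card B = DIM(real^'n)" "\<And>x. x \<in> B \<Longrightarrow> \<exists>c. A *v x = c *\<^sub>R x"
    using selfadjoint_orthonormal_eigenbasis[of "(*v) A"] matrix_vector_mul_linear by metis
  obtain b :: "'n \<Rightarrow> real^'n" where b: "bij_betw b UNIV B"
      "\<And>i j. b i \<bullet> b j = (if i = j then 1 else 0)"
    using orthonormal_set_enumeration[of B] B by auto
  have "\<forall>i. \<exists>c. A *v b i = c *\<^sub>R b i"
    using B(4) b(1) by (auto simp: bij_betw_def)
  then obtain d where "\<forall>i. A *v b i = d i *\<^sub>R b i"
    by metis
  with b(2) that show ?thesis
    unfolding orthonormal_eigenbasis_def by blast
qed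

text \<open>The relation \<open>A P = P E\<close> with \<open>E\<close> diagonal is lifted to
  matrices over the polynomial ring, where \<open>X - C A\<close> and \<open>X - C E\<close> are
  intertwined by \<open>C P\<close>. Taking determinants, the nonzero factor
  \<open>det (C P)\<close> cancels in the integral domain.\<close>

lemma charpoly_orthonormal_eigenbasis:
  fixes A :: "real^'n^'n"
  assumes "orthonormal_eigenbasis A d b"
  shows "charpoly A = (\<Prod>i\<in>UNIV. [:- d i, 1:])"
proof -
  define C :: "real^'n^'n \<Rightarrow> real poly^'n^'n" where "C M = (\<chi> i j. [:M $ i $ j:])" for M
  define P :: "real^'n^'n" where "P = (\<chi> i j. b j $ i)"
  define E :: "real^'n^'n" where "E = (\<chi> i j. if i = j then d i else 0)"
  define X :: "real poly^'n^'n" where "X = mat [:0, 1:]"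
  have const_sum: "[:sum g S:] = (\<Sum>k\<in>S. [:g k:])" for g :: "'n \<Rightarrow> real" and S
    by (rule poly_eqI) (simp add: coeff_sum coeff_pCons split: nat.split)
  have C_mult: "C (M ** N) = C M ** C N" for M N
    by (simp add: C_def matrix_matrix_mult_def const_sum vec_eq_iff) (simp add: mult.commute)
  have PP: "transpose P ** P = mat 1"
    using assms by (simp add: P_def transpose_def matrix_matrix_mult_def mat_def vec_eq_iff
        orthonormal_eigenbasis_def inner_vec_def)
  have "A ** P = P ** E"
  proof -
    have "(A *v b j) $ i = d j * b j $ i" for i j
      using assms by (simp add: orthonormal_eigenbasis_def)
    then show ?thesis
      by (simp add: P_def E_def matrix_matrix_mult_def matrix_vector_mult_def vec_eq_iff
          if_distrib sum.delta mult.commute cong: if_cong)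
  qed
  then have CAP: "C A ** C P = C P ** C E"
    by (metis C_mult)
  \<comment> \<open>\<open>X\<close> is a scalar matrix, hence central.\<close>
  have X_comm: "X ** M = M ** X" for M
    by (simp add: X_def matrix_matrix_mult_def mat_def vec_eq_iff if_distrib if_distribR
        sum.delta sum.delta' mult.commute cong: if_cong)
  have "C (mat 1) = mat 1"
    by (simp add: C_def mat_def vec_eq_iff one_pCons)
  then have "det (C (transpose P)) * det (C P) = 1"
    by (metis C_mult PP det_mul det_I)
  then have unit: "det (C P) \<noteq> 0"
    by auto
  have "(X - C A) ** C P = X ** C P - C A ** C P" "C P ** (X - C E) = C P ** X - C P ** C E"
    by (simp_all add: matrix_matrix_mult_def vec_eq_iff left_diff_distrib right_diff_distrib
        sum_subtractf)
  then have "(X - C A) ** C P = C P ** (X - C E)"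
    by (simp add: CAP X_comm)
  then have "det (X - C A) * det (C P) = det (C P) * det (X - C E)"
    by (simp flip: det_mul)
  then have "det (X - C A) = det (X - C E)"
    using unit by (simp add: mult.commute)
  also have "\<dots> = (\<Prod>i\<in>UNIV. (X - C E) $ i $ i)"
    by (rule det_diagonal) (simp add: X_def C_def E_def mat_def)
  also have "\<dots> = (\<Prod>i\<in>UNIV. [:- d i, 1:])"
    by (simp add: X_def C_def E_def mat_def)
  finally show ?thesis
    by (simp add: charpoly_def X_def C_def)
qed

lemma eigenvalues_orthonormal_eigenbasis:
  assumes "orthonormal_eigenbasis A d b"
  shows "eigenvalues A = image_mset d (mset_set UNIV)"
proof -
  have "eigenvalues A = (\<Sum>i\<in>UNIV. {#d i#})"
    by (simp add: eigenvalues_def charpoly_orthonormal_eigenbasis[OF assms] proots_prod)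
  also have "\<dots> = image_mset d (mset_set UNIV)"
    by (induction rule: finite_induct[OF finite]) auto
  finally show ?thesis .
qed

text \<open>The kernel is the orthogonal complement of the range of \<open>transpose A\<close>,
  whose dimension is again the rank.\<close>

lemma rank_plus_dim_kernel:
  fixes A :: "real^'n^'m"
  shows "rank A + dim {u. A *v u = 0} = CARD('n)"
proof -
  have "(\<forall>x\<in>range ((*v) (transpose A)). orthogonal x u) \<longleftrightarrow> A *v u = 0" for u
  proof -
    have "(transpose A *v y) \<bullet> u = y \<bullet> (A *v u)" for y
      by (simp add: dot_lmul_matrix transpose_matrix_vector)
    then show ?thesis
      by (auto simp: orthogonal_def) (metis inner_eq_zero_iff)
  qed
  then have "{u. A *v u = 0} = {u \<in> UNIV. \<forall>x\<in>range ((*v) (transpose A)). orthogonal x u}"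
    by auto
  moreover have "rank A = dim (range ((*v) (transpose A)))"
    by (metis rank_dim_range rank_transpose)
  ultimately show ?thesis
    using dim_subspace_orthogonal_to_vectors[of "range ((*v) (transpose A))" UNIV]
    by (simp add: linear_subspace_image del: transpose_matrix_vector)
qed

section \<open>Tensor products of vectors and Kronecker products of matrices\<close>

definition tensor :: "real^'m \<Rightarrow> real^'d \<Rightarrow> real^('m \<times> 'd)" where
  "tensor u w = (\<chi> p. u $ fst p * w $ snd p)"

text \<open>This is \<open>transpose (matrix_of_vec z) *v u\<close>, the adjoint of
  \<open>tensor u\<close>. For \<open>u = v\<close> it is the linear predictor computed by the
  network with weights \<open>z\<close>.\<close>

definition contract :: "real^'m \<Rightarrow> real^('m \<times> 'd) \<Rightarrow> real^'d" where
  "contract u z = (\<chi> i. \<Sum>j\<in>UNIV. u $ j * z $ (j, i))"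

lemma sum_UNIV_Times:
  "(\<Sum>p\<in>UNIV. g p) = (\<Sum>j\<in>UNIV. \<Sum>i\<in>UNIV. g (j, i))"
  for g :: "'m::finite \<times> 'd::finite \<Rightarrow> 'a::comm_monoid_add"
  by (simp add: sum.cartesian_product flip: UNIV_Times_UNIV)

lemma inner_tensor: "tensor u w \<bullet> z = w \<bullet> contract u z"
proof -
  have "tensor u w \<bullet> z = (\<Sum>j\<in>UNIV. \<Sum>i\<in>UNIV. u $ j * w $ i * z $ (j, i))"
    by (simp add: tensor_def inner_vec_def sum_UNIV_Times)
  also have "\<dots> = w \<bullet> contract u z"
    by (subst sum.swap) (simp add: contract_def inner_vec_def sum_distrib_left ac_simps)
  finally show ?thesis .
qed

lemma contract_tensor: "contract u (tensor u' w) = (u \<bullet> u') *\<^sub>R w"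
  by (simp add: contract_def tensor_def vec_eq_iff inner_vec_def sum_distrib_left ac_simps)

lemma inner_tensor_tensor: "tensor u w \<bullet> tensor u' w' = (u \<bullet> u') * (w \<bullet> w')"
  by (simp add: inner_tensor contract_tensor)

lemma linear_tensor: "linear (tensor u)"
  by (rule linearI) (simp_all add: tensor_def vec_eq_iff algebra_simps)

text \<open>Contraction with \<open>u\<close> is a left inverse up to the nonzero factor
  \<open>u \<bullet> u\<close>.\<close>

lemma inj_tensor:
  assumes "u \<noteq> 0"
  shows "inj (tensor u)"
proof -
  have "contract u (tensor u w) = (u \<bullet> u) *\<^sub>R w" for w
    by (rule contract_tensor)
  then show ?thesis
    using assms by (metis injI inner_eq_zero_iff real_vector.scale_left_imp_eq)
qed

lemma kronecker_mult_tensor: "kronecker A B *v tensor u w = tensor (A *v u) (B *v w)"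
  by (simp add: kronecker_def tensor_def matrix_vector_mult_def vec_eq_iff sum_UNIV_Times
      sum_product ac_simps)

text \<open>Factors the matrix as \<open>B\<close> between \<open>contract v\<close> and its adjoint
  \<open>tensor v\<close>; both the range and the quadratic form are read off from this.\<close>

lemma kronecker_outer_product_mult:
  "kronecker (outer_product v v) B *v z = tensor v (B *v contract v z)"
proof -
  have "(\<Sum>k\<in>UNIV. \<Sum>l\<in>UNIV. v $ j * v $ k * B $ i $ l * z $ (k, l))
      = v $ j * (\<Sum>l\<in>UNIV. B $ i $ l * (\<Sum>k\<in>UNIV. v $ k * z $ (k, l)))" for j i
    by (subst sum.swap) (simp add: sum_distrib_left ac_simps)
  then show ?thesis
    by (simp add: kronecker_def outer_product_def tensor_def contract_def matrix_vector_mult_def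
        vec_eq_iff sum_UNIV_Times)
qed

lemma outer_product_mult: "outer_product u v *v w = (v \<bullet> w) *\<^sub>R u"
  by (simp add: outer_product_def matrix_vector_mult_def vec_eq_iff inner_vec_def
      sum_distrib_left sum_distrib_right ac_simps)

text \<open>Inner products and eigenvalues both multiply across the two tensor factors.\<close>

lemma kronecker_orthonormal_eigenbasis:
  assumes "orthonormal_eigenbasis A e a" "orthonormal_eigenbasis B d b"
  shows "orthonormal_eigenbasis (kronecker A B) (\<lambda>(j, i). e j * d i) (\<lambda>(j, i). tensor (a j) (b i))"
proof -
  have "tensor (r *\<^sub>R u) (s *\<^sub>R w) = (r * s) *\<^sub>R tensor u w"
    for r s and u :: "real^'m" and w :: "real^'n"
    by (simp add: tensor_def vec_eq_iff)
  then show ?thesis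
    using assms by (auto simp: orthonormal_eigenbasis_def inner_tensor_tensor kronecker_mult_tensor)
qed

section \<open>Spectrum and rank of \<open>kronecker (outer_product v v) A\<close>\<close>

text \<open>The normalised \<open>v\<close> is completed to an orthonormal basis, with
  \<open>j0\<close> its index; the matrix annihilates every vector orthogonal to
  \<open>v\<close>.\<close>

lemma outer_product_eigenbasis:
  fixes v :: "real^'m"
  assumes "v \<noteq> 0"
  obtains j0 a where
    "orthonormal_eigenbasis (outer_product v v) (\<lambda>j. if j = j0 then (norm v)\<^sup>2 else 0) a"
proof -
  define u where "u = v /\<^sub>R norm v"
  have v: "v = norm v *\<^sub>R u"
    using assms by (simp add: u_def)
  have "norm u = 1"
    using assms by (simp add: u_def)
  then obtain B where B: "u \<in> B" "pairwise orthogonal B" "\<And>x. x \<in> B \<Longrightarrow> norm x = 1"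
      "card B = DIM(real^'m)"
    using vector_in_orthonormal_basis by metis
  obtain a :: "'m \<Rightarrow> real^'m" where a: "bij_betw a UNIV B"
      "\<And>i j. a i \<bullet> a j = (if i = j then 1 else 0)"
    using orthonormal_set_enumeration[of B] B by auto
  obtain j0 where j0: "a j0 = u"
    using a(1) B(1) by (auto simp: bij_betw_def)
  have "outer_product v v *v a j = (if j = j0 then (norm v)\<^sup>2 else 0) *\<^sub>R a j" for j
  proof -
    have "v \<bullet> a j = (if j = j0 then norm v else 0)"
      by (subst v) (simp add: a(2) flip: j0)
    then show ?thesis
      by (simp add: outer_product_mult j0) (metis v scaleR_scaleR power2_eq_square)
  qed
  with a(2) that show ?thesis
    unfolding orthonormal_eigenbasis_def by blast
qed

lemma eigenvalue_pos:
  assumes "positive_definite A" "orthonormal_eigenbasis A d b"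
  shows "d i > 0"
proof -
  have bi: "b i \<bullet> b i = 1" "A *v b i = d i *\<^sub>R b i"
    using assms(2) by (auto simp: orthonormal_eigenbasis_def)
  then have "b i \<noteq> 0" by auto
  then have "b i \<bullet> (A *v b i) > 0"
    using assms(1) by (auto simp: positive_definite_def)
  with bi show ?thesis by simp
qed

text \<open>In the product eigenbasis the eigenvalue at \<open>(j, i)\<close> is nonzero exactly
  when \<open>j = j0\<close>, as each \<open>d i\<close> is positive. Reindexing this slice by
  \<open>Pair j0\<close> preserves multiplicities.\<close>

lemma nonzero_eigenvalues_kronecker_outer_product:
  fixes v :: "real^'m" and A :: "real^'d^'d"
  assumes "positive_definite A" "v \<noteq> 0"
  shows "filter_mset (\<lambda>t. t \<noteq> 0) (eigenvalues (kronecker (outer_product v v) A)) =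
    image_mset (\<lambda>l. (norm v)\<^sup>2 * l) (eigenvalues A)"
proof -
  obtain d b where A: "orthonormal_eigenbasis A d b"
    using assms(1) symmetric_matrix_eigenbasis by (auto simp: positive_definite_def)
  obtain j0 a where v:
    "orthonormal_eigenbasis (outer_product v v) (\<lambda>j. if j = j0 then (norm v)\<^sup>2 else 0) a"
    using outer_product_eigenbasis[OF assms(2)] by metis
  define h :: "'m \<times> 'd \<Rightarrow> real" where "h = (\<lambda>(j, i). (if j = j0 then (norm v)\<^sup>2 else 0) * d i)"
  have "h p \<noteq> 0 \<longleftrightarrow> p \<in> Pair j0 ` UNIV" for p
    using eigenvalue_pos[OF assms(1) A, of "snd p"] assms(2)
    by (cases p) (auto simp: h_def)
  then have "{p. h p \<noteq> 0} = Pair j0 ` UNIV"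
    by blast
  then have "filter_mset (\<lambda>t. t \<noteq> 0) (image_mset h (mset_set UNIV))
      = image_mset h (mset_set (Pair j0 ` UNIV))"
    by (simp add: filter_mset_image_mset filter_mset_mset_set)
  also have "mset_set (Pair j0 ` (UNIV :: 'd set)) = image_mset (Pair j0) (mset_set UNIV)"
    by (simp add: image_mset_mset_set inj_on_def)
  also have "image_mset h \<dots> = image_mset (\<lambda>l. (norm v)\<^sup>2 * l) (image_mset d (mset_set UNIV))"
    by (simp add: h_def multiset.map_comp comp_def)
  finally show ?thesis
    using eigenvalues_orthonormal_eigenbasis[OF A]
      eigenvalues_orthonormal_eigenbasis[OF kronecker_orthonormal_eigenbasis[OF v A]]
    by (simp add: h_def)
qed

text \<open>Definiteness makes \<open>A\<close> bijective and \<open>contract v\<close> is onto, so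
  the range is that of the injective map \<open>tensor v\<close>.\<close>

lemma rank_kronecker_outer_product:
  fixes v :: "real^'m" and A :: "real^'d^'d"
  assumes "positive_definite A" "v \<noteq> 0"
  shows "rank (kronecker (outer_product v v) A) = CARD('d)"
proof -
  have "\<forall>u. A *v u = 0 \<longrightarrow> u = 0"
    using assms(1) by (metis inner_zero_right less_irrefl positive_definite_def)
  then have "inj ((*v) A)"
    by (simp add: linear_injective_0)
  then have surj: "surj ((*v) A)"
    by (metis full_rank_injective full_rank_surjective)
  have "tensor v w \<in> range ((*v) (kronecker (outer_product v v) A))" for w
  proof -
    obtain y where y: "w = A *v y"
      using surj by (metis surjD)
    \<comment> \<open>A preimage of \<open>y\<close> under \<open>contract v\<close>; the scaling
      undoes the factor \<open>v \<bullet> v\<close>.\<close>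
    have "contract v (tensor v (y /\<^sub>R (v \<bullet> v))) = y"
      using assms(2) by (simp add: contract_tensor)
    then show ?thesis
      using kronecker_outer_product_mult y by (metis rangeI)
  qed
  then have "range ((*v) (kronecker (outer_product v v) A)) = range (tensor v)"
    by (auto simp: kronecker_outer_product_mult)
  then have "rank (kronecker (outer_product v v) A) = dim (range (tensor v :: real^'d \<Rightarrow> _))"
    by (simp add: rank_dim_range)
  also have "\<dots> = dim (UNIV :: (real^'d) set)"
    by (intro dim_image_eq linear_tensor inj_on_subset[OF inj_tensor[OF assms(2)]]) auto
  finally show ?thesis by simp
qed

section \<open>The loss as a quadratic polynomial and its Hessian\<close>

text \<open>By symmetry the two terms of the product rule agree and cancel the factor 1/2, so the
  gradient is the affine map \<open>H *v x - b\<close>.\<close>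

lemma has_hessian_quadratic:
  fixes H :: "real^'n^'n"
  assumes "transpose H = H"
  shows "has_hessian (\<lambda>w. (w \<bullet> (H *v w)) / 2 - w \<bullet> b + c) H a"
proof -
  have H: "((*v) H has_derivative (*v) H) (at x)" for x
    by (simp add: bounded_linear_imp_has_derivative)
  have sym: "x \<bullet> (H *v h) = h \<bullet> (H *v x)" for x h
    by (metis assms dot_lmul_matrix inner_commute transpose_matrix_vector)
  have "GDERIV (\<lambda>w. (w \<bullet> (H *v w)) / 2 - w \<bullet> b + c) x :> H *v x - b" for x
    unfolding gderiv_def
    by (rule derivative_eq_intros H | simp)+ (auto simp: inner_diff_right sym)
  moreover have "((\<lambda>x. H *v x - b) has_derivative (*v) H) (at a)"
    by (rule derivative_eq_intros H | simp)+
  ultimately show ?thesis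
    unfolding has_hessian_def by (intro exI[of _ "\<lambda>x. H *v x - b"]) auto
qed

text \<open>The loss depends on \<open>w\<close> only through \<open>a = contract v w\<close>;
  expanding the square \<open>(a \<bullet> x - y)\<^sup>2\<close> and integrating termwise leaves
  only second moments.\<close>

lemma loss_quadratic:
  fixes D :: "((real^'d) \<times> real) measure" and v :: "real^'m"
  assumes "data_distribution D"
  obtains c s where "\<And>w. loss D v (matrix_of_vec w) =
    (w \<bullet> (kronecker (outer_product v v) (second_moment D) *v w)) / 2 - w \<bullet> tensor v c + s"
proof -
  have sets: "sets D = sets borel"
    and int: "integrable D (\<lambda>(x, y). (norm x)\<^sup>2)" "integrable D (\<lambda>(x, y). y\<^sup>2)"
    using assms by (auto simp: data_distribution_def)
  have meas: "f \<in> borel_measurable D" if "continuous_on UNIV f" for f :: "(real^'d) \<times> real \<Rightarrow> real"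
    using borel_measurable_continuous_onI[OF that] by (simp only: measurable_cong_sets[OF sets refl])
  \<comment> \<open>Splitting the integral requires each monomial to be integrable; the mixed ones
    are dominated by \<open>(norm x)\<^sup>2\<close> and \<open>y\<^sup>2\<close>.\<close>
  have xx: "integrable D (\<lambda>(x, y). x $ i * x $ k)" for i k
  proof (rule Bochner_Integration.integrable_bound[OF int(1)])
    show "AE z in D. norm (case z of (x, y) \<Rightarrow> x $ i * x $ k) \<le> norm (case z of (x, y) \<Rightarrow> (norm x)\<^sup>2)"
      by (auto intro!: AE_I2 mult_mono component_le_norm_cart simp: abs_mult power2_eq_square
          split: prod.split)
  qed (unfold case_prod_beta, rule meas, intro continuous_intros)
  have xy: "integrable D (\<lambda>(x, y). x $ i * y)" for i
  proof (rule Bochner_Integration.integrable_bound[OF Bochner_Integration.integrable_add[OF int]])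
    have "\<bar>x $ i * y\<bar> \<le> (norm x)\<^sup>2 + y\<^sup>2" for x :: "real^'d" and y
    proof -
      have "\<bar>x $ i * y\<bar> \<le> norm x * \<bar>y\<bar>"
        by (simp add: abs_mult component_le_norm_cart mult_right_mono)
      also have "\<dots> \<le> (norm x)\<^sup>2 + y\<^sup>2"
        using sum_squares_bound[of "norm x" "\<bar>y\<bar>"] mult_nonneg_nonneg[of "norm x" "\<bar>y\<bar>"]
        by (simp add: power2_abs mult.assoc del: mult_nonneg_nonneg)
      finally show ?thesis .
    qed
    then show "AE z in D. norm (case z of (x, y) \<Rightarrow> x $ i * y)
        \<le> norm ((case z of (x, y) \<Rightarrow> (norm x)\<^sup>2) + (case z of (x, y) \<Rightarrow> y\<^sup>2))"
      by auto
  qed (unfold case_prod_beta, rule meas, intro continuous_intros)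
  \<comment> \<open>\<open>c\<close> is the cross moment of \<open>x\<close> and \<open>y\<close>,
    and \<open>s\<close> is the loss at \<open>W = 0\<close>.\<close>
  define c :: "real^'d" where "c = (\<chi> i. \<integral>(x, y). x $ i * y \<partial>D)"
  define s where "s = (\<integral>(x, y). y\<^sup>2 \<partial>D) / 2"
  have "loss D v (matrix_of_vec w) =
    (w \<bullet> (kronecker (outer_product v v) (second_moment D) *v w)) / 2 - w \<bullet> tensor v c + s" for w
  proof -
    define a where "a = contract v w"
    have "v \<bullet> (matrix_of_vec w *v x) = a \<bullet> x" for x
    proof -
      have "v \<bullet> (matrix_of_vec w *v x) = (\<Sum>j\<in>UNIV. \<Sum>i\<in>UNIV. v $ j * (w $ (j, i) * x $ i))"
        by (simp add: inner_vec_def matrix_of_vec_def matrix_vector_mult_def sum_distrib_left)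
      also have "\<dots> = a \<bullet> x"
        by (subst sum.swap) (simp add: a_def contract_def inner_vec_def sum_distrib_left ac_simps)
      finally show ?thesis .
    qed
    moreover have "(a \<bullet> x - y)\<^sup>2 = (\<Sum>i\<in>UNIV. \<Sum>k\<in>UNIV. a $ i * a $ k * (x $ i * x $ k))
        - (\<Sum>i\<in>UNIV. 2 * a $ i * (x $ i * y)) + y\<^sup>2" for x y
    proof -
      have "(a \<bullet> x - y)\<^sup>2 = (a \<bullet> x) * (a \<bullet> x) - 2 * (a \<bullet> x) * y + y\<^sup>2"
        by (simp add: power2_eq_square algebra_simps)
      then show ?thesis
        by (simp add: inner_vec_def sum_product sum_distrib_left sum_distrib_right ac_simps)
    qed
    ultimately have "loss D v (matrix_of_vec w) = 1 / 2 *
        (\<integral>z. (\<Sum>i\<in>UNIV. \<Sum>k\<in>UNIV. a $ i * a $ k * (case z of (x, y) \<Rightarrow> x $ i * x $ k))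
        - (\<Sum>i\<in>UNIV. 2 * a $ i * (case z of (x, y) \<Rightarrow> x $ i * y)) + (case z of (x, y) \<Rightarrow> y\<^sup>2) \<partial>D)"
      by (simp add: loss_def case_prod_unfold)
    also have "\<dots> = 1 / 2 * ((\<Sum>i\<in>UNIV. \<Sum>k\<in>UNIV. a $ i * a $ k * second_moment D $ i $ k)
        - (\<Sum>i\<in>UNIV. 2 * a $ i * c $ i) + 2 * s)"
      using xx xy int(2)
      by (simp add: Bochner_Integration.integral_add Bochner_Integration.integral_diff
          Bochner_Integration.integral_sum second_moment_def c_def s_def)
    also have "\<dots> = (a \<bullet> (second_moment D *v a)) / 2 - c \<bullet> a + s"
      by (simp add: inner_vec_def matrix_vector_mult_def sum_distrib_left sum_divide_distrib
          algebra_simps)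
    \<comment> \<open>Adjointness of \<open>contract v\<close> and \<open>tensor v\<close> moves the
      quadratic form from \<open>a\<close> to \<open>w\<close>.\<close>
    also have "a \<bullet> (second_moment D *v a)
        = w \<bullet> (kronecker (outer_product v v) (second_moment D) *v w)"
      by (metis a_def inner_commute inner_tensor kronecker_outer_product_mult)
    also have "c \<bullet> a = w \<bullet> tensor v c"
      by (simp add: a_def inner_commute flip: inner_tensor)
    finally show ?thesis .
  qed
  with that show ?thesis by blast
qed

lemma transpose_kronecker: "transpose (kronecker A B) = kronecker (transpose A) (transpose B)"
  by (simp add: kronecker_def transpose_def)

lemma transpose_outer_product: "transpose (outer_product u v) = outer_product v u"
  by (simp add: outer_product_def transpose_def vec_eq_iff)

theorem proposition7p4:
  fixes D :: "((real^'d) \<times> real) measure"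
    and v :: "real^'m"
  assumes "data_distribution D"
    and "positive_definite (second_moment D)"
    and "v \<noteq> 0"
  shows "let Sigma = second_moment D; H0 = kronecker (outer_product v v) Sigma in
      (\<forall>W :: real^'d^'m.
         has_hessian (\<lambda>w. loss D v (matrix_of_vec w)) H0 (vec_of_matrix W)) \<and>
      rank H0 = CARD('d) \<and>
      dim {u. H0 *v u = 0} = (CARD('m) - 1) * CARD('d) \<and>
      size (eigenvalues Sigma) = CARD('d) \<and>
      filter_mset (\<lambda>t. t \<noteq> 0) (eigenvalues H0) =
        image_mset (\<lambda>l. (norm v)\<^sup>2 * l) (eigenvalues Sigma)"
proof -
  define A where "A = second_moment D"
  define H where "H = kronecker (outer_product v v) A"
  have A: "positive_definite A" "transpose A = A"
    using assms(2) by (auto simp: A_def positive_definite_def)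
  have "transpose H = H"
    by (simp add: H_def transpose_kronecker transpose_outer_product A(2))
  moreover obtain c s where
    "\<And>w. loss D v (matrix_of_vec w) = (w \<bullet> (H *v w)) / 2 - w \<bullet> tensor v c + s"
    using loss_quadratic[OF assms(1), of v] unfolding H_def A_def by metis
  ultimately have hess: "has_hessian (\<lambda>w. loss D v (matrix_of_vec w)) H a" for a
    using has_hessian_quadratic[of H "tensor v c" s a] by simp
  have rank: "rank H = CARD('d)"
    unfolding H_def by (rule rank_kronecker_outer_product[OF A(1) assms(3)])
  \<comment> \<open>Rank and nullity add up to \<open>CARD('m) * CARD('d)\<close>; since index types
    are nonempty, \<open>CARD('m) - 1\<close> is not truncated.\<close>
  have "dim {u. H *v u = 0} = (CARD('m) - 1) * CARD('d)"
    using rank_plus_dim_kernel[of H] rank by (simp add: diff_mult_distrib)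
  \<comment> \<open>\<open>eigenvalues\<close> collects real roots only; the eigenbasis shows that
    the characteristic polynomial of \<open>A\<close> splits over the reals, so none are
    missing.\<close>
  moreover obtain d b where "orthonormal_eigenbasis A d b"
    using symmetric_matrix_eigenbasis[OF A(2)] by metis
  then have "size (eigenvalues A) = CARD('d)"
    by (simp add: eigenvalues_orthonormal_eigenbasis)
  ultimately show ?thesis
    using hess rank nonzero_eigenvalues_kronecker_outer_product[OF A(1) assms(3)]
    unfolding Let_def H_def A_def by blast
qed

end
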